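(* Let $\bar u\in U_{ad}\cap L^\infty(Q)$, let $\bar y=y_{\bar u}$ and $\bar\varphi\in C(\bar Q)\cap H^1(Q)$ be its state and adjoint state, and let $\bar\mu\in L^\infty(Q)$ be such that $\bar\varphi+\kappa\bar u+\bar\mu=0$ and (a) $\bar u(x,t)\bar\mu(x,t)=|\bar u(x,t)||\bar\mu(x,t)|$ for a.a. $(x,t)\in Q$; (b) for a.a. $t\in(0,T)$: if $\|\bar u(t)\|_{L^1(\Omega)}<\gamma$ then $\bar\mu(t)\equiv0$ in $\Omega$; (c) for a.a. $t\in(0,T)$: if $\|\bar u(t)\|_{L^1(\Omega)}=\gamma$ and $\bar\mu(t)\not\equiv0$ in $\Omega$, then $\operatorname{supp}(\bar u(t))\subset\{x\in\Omega:|\bar\mu(x,t)|=\|\bar\mu(t)\|_{L^\infty(\Omega)}\}$. Then, for a.a. $(x,t)\in Q$, $$\bar u(x,t)=0\quad\text{if and only if}\quad|\bar\varphi(x,t)|\le\|\bar\mu(t)\|_{L^\infty(\Omega)}.$$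
   Context: Setting: $\Omega\subset\mathbb{R}^n$, $n\in\{2,3\}$, is a bounded, connected, open set with Lipschitz boundary $\Gamma$, $0<T<\infty$, $Q=\Omega\times(0,T)$, $\Sigma=\Gamma\times(0,T)$. $Ay=-\sum_{i,j=1}^n\partial_{x_j}(a_{ij}(x)\partial_{x_i}y)$ and $A^*\varphi=-\sum_{i,j=1}^n\partial_{x_j}(a_{ji}(x)\partial_{x_i}\varphi)$ with $a_{ij}\in L^\infty(\Omega)$ and, for some $\Lambda_A>0$, $\Lambda_A|\xi|^2\le\sum_{i,j=1}^n a_{ij}(x)\xi_i\xi_j$ for all $\xi\in\mathbb{R}^n$ and a.a. $x\in\Omega$. $y_0\in L^\infty(\Omega)$. $a:Q\times\mathbb{R}\to\mathbb{R}$ is a Carathéodory function, of class $C^2$ in the last variable, such that for a.a. $(x,t)\in Q$: (i) there is $C_a\in\mathbb{R}$ with $\frac{\partial a}{\partial y}(x,t,y)\ge C_a$ for all $y\in\mathbb{R}$; (ii) $a(\cdot,\cdot,0)\in L^{\hat r}(0,T;L^{\hat p}(\Omega))$ with $\hat r,\hat p\ge2$ and $\frac1{\hat r}+\frac{n}{2\hat p}<1$; (iii) for all $M>0$ there is $C_{a,M}>0$ with $|\frac{\partial^ja}{\partial y^j}(x,t,y)|\le C_{a,M}$ for all $|y|\le M$, $j=1,2$; (iv) for all $\rho>0$ and $M>0$ there is $\varepsilon>0$ with $|\frac{\partial^2a}{\partial y^2}(x,t,y_1)-\frac{\partial^2a}{\partial y^2}(x,t,y_2)|<\rho$ whenever $|y_1|,|y_2|\le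 M$, $|y_1-y_2|<\varepsilon$. Also $y_d\in L^{\hat r}(0,T;L^{\hat p}(\Omega))$, $\kappa>0$, $0<\gamma<\infty$. $W(0,T)=\{y\in L^2(0,T;H_0^1(\Omega)):\frac{\partial y}{\partial t}\in L^2(0,T;H^{-1}(\Omega))\}$. Equations are understood in the weak sense. For $u\in L^\infty(Q)$, $y_u\in L^\infty(Q)\cap W(0,T)$ is the unique solution of $\frac{\partial y}{\partial t}+Ay+a(x,t,y)=u$ in $Q$, $y=0$ on $\Sigma$, $y(0)=y_0$ in $\Omega$. The adjoint state $\bar\varphi$ of $\bar u$ is the solution of $-\frac{\partial\bar\varphi}{\partial t}+A^*\bar\varphi+\frac{\partial a}{\partial y}(x,t,\bar y)\bar\varphi=\bar y-y_d$ in $Q$, $\bar\varphi=0$ on $\Sigma$, $\bar\varphi(T)=0$ in $\Omega$. $U_{ad}=\{u\in L^\infty(0,T;L^1(\Omega)):\|u(t)\|_{L^1(\Omega)}\le\gamma\text{ for a.a. }t\in(0,T)\}$. Convention: $\operatorname{supp}(\bar u(t))$ stands for $\{x\in\Omega:\bar u(x,t)\ne0\}$ and the inclusion in (c) is up to Lebesgue null sets. *)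

theory Defs
  imports "HOL-Probability.Essential_Supremum"
begin

text \<open>
  Elements of the function spaces are represented by functions defined on the whole type, of which
  only the values on \<open>\<Omega>\<close>, \<open>Q = \<Omega> \<times> (0,T)\<close>, etc. matter, up to Lebesgue null sets.  A function \<open>f\<close> on
  the space-time cylinder is identified with the vector-valued function \<open>t \<mapsto> f(\<cdot>,t)\<close>.
\<close>

section \<open>Domains\<close>

text \<open>Near each boundary point the set is the part lying strictly above the graph of a Lipschitz
  function, in Cartesian coordinates with last axis \<open>\<nu>\<close> and origin at that point.\<close>

definition lipschitz_boundary :: "'a::euclidean_space set \<Rightarrow> bool" where
  "lipschitz_boundary \<Omega> \<longleftrightarrow>
     (\<forall>p\<in>frontier \<Omega>. \<exists>\<nu> g L r. norm \<nu> = 1 \<and> L-lipschitz_on {z. z \<bullet> \<nu> = 0} g \<and> 0 < r \<and>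
        (\<forall>x\<in>ball p r. x \<in> \<Omega> \<longleftrightarrow> g ((x - p) - ((x - p) \<bullet> \<nu>) *\<^sub>R \<nu>) < (x - p) \<bullet> \<nu>))"

definition cylinder :: "'a set \<Rightarrow> real \<Rightarrow> ('a \<times> real) set" where
  "cylinder \<Omega> T = \<Omega> \<times> {0<..<T}"


section \<open>Lebesgue and Bochner spaces\<close>

definition Lp_norm :: "'a measure \<Rightarrow> ennreal \<Rightarrow> ('a \<Rightarrow> real) \<Rightarrow> real" where
  "Lp_norm M p f =
     (if p = \<infinity> then real_of_ereal (esssup M (\<lambda>x. ereal \<bar>f x\<bar>))
      else (LINT x|M. \<bar>f x\<bar> powr enn2real p) powr (1 / enn2real p))"

definition Lp_space :: "'a measure \<Rightarrow> ennreal \<Rightarrow> ('a \<Rightarrow> real) set" where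
  "Lp_space M p =
     {f \<in> borel_measurable M.
        if p = \<infinity> then esssup M (\<lambda>x. ereal \<bar>f x\<bar>) < \<infinity>
        else integrable M (\<lambda>x. \<bar>f x\<bar> powr enn2real p)}"

text \<open>The Bochner space \<open>L\<^sup>p(I;X)\<close>, for \<open>X\<close> given by a set \<open>V\<close> of representatives with seminorm \<open>N\<close>:
  almost everywhere limits of simple functions whose norm is in \<open>L\<^sup>p(I)\<close>.\<close>

definition bochner_simple :: "real set \<Rightarrow> 'b set \<Rightarrow> (real \<Rightarrow> 'b) \<Rightarrow> bool" where
  "bochner_simple I V s \<longleftrightarrow>
     finite (s ` I) \<and> s ` I \<subseteq> V \<and> (\<forall>v. {t\<in>I. s t = v} \<in> sets lebesgue)"

definition bochner_space ::
    "real set \<Rightarrow> ennreal \<Rightarrow> 'b::minus set \<Rightarrow> ('b \<Rightarrow> real) \<Rightarrow> (real \<Rightarrow> 'b) set" where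
  "bochner_space I p V N =
     {f. (\<exists>s. (\<forall>k::nat. bochner_simple I V (s k)) \<and>
              (AE t in lebesgue_on I. f t \<in> V \<and> (\<lambda>k. N (f t - s k t)) \<longlonglongrightarrow> 0)) \<and>
         (\<lambda>t. N (f t)) \<in> Lp_space (lebesgue_on I) p}"

text \<open>\<open>L\<^sup>r(0,T;L\<^sup>p(\<Omega>))\<close>, represented by jointly measurable functions on \<open>Q\<close>.\<close>

definition LrLp ::
    "'a::euclidean_space set \<Rightarrow> real \<Rightarrow> ennreal \<Rightarrow> ennreal \<Rightarrow> ('a \<times> real \<Rightarrow> real) set" where
  "LrLp \<Omega> T r p =
     {f \<in> borel_measurable (lebesgue_on (cylinder \<Omega> T)).
        (\<lambda>t x. f (x, t)) \<in>
          bochner_space {0<..<T} r (Lp_space (lebesgue_on \<Omega>) p) (Lp_norm (lebesgue_on \<Omega>) p)}"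

definition Linf_Q :: "'a::euclidean_space set \<Rightarrow> real \<Rightarrow> ('a \<times> real \<Rightarrow> real) set" where
  "Linf_Q \<Omega> T = Lp_space (lebesgue_on (cylinder \<Omega> T)) \<infinity>"


section \<open>Sobolev spaces\<close>

primrec Ck :: "nat \<Rightarrow> ('a::euclidean_space \<Rightarrow> real) \<Rightarrow> bool" where
  "Ck 0 = (\<lambda>f. continuous_on UNIV f)"
| "Ck (Suc k) = (\<lambda>f. (\<forall>x. f differentiable (at x)) \<and>
     (\<forall>b\<in>Basis. Ck k (\<lambda>x. frechet_derivative f (at x) b)))"

text \<open>\<open>C\<^sub>c\<^sup>\<infinity>(U)\<close>, its elements being extended by zero to the whole space.\<close>

definition test_functions :: "'a::euclidean_space set \<Rightarrow> ('a \<Rightarrow> real) set" where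
  "test_functions U =
     {\<phi>. (\<forall>k. Ck k \<phi>) \<and> compact (closure {x. \<phi> x \<noteq> 0}) \<and> closure {x. \<phi> x \<noteq> 0} \<subseteq> U}"

definition L2 :: "'a::euclidean_space set \<Rightarrow> ('a \<Rightarrow> real) set" where
  "L2 U = Lp_space (lebesgue_on U) 2"

definition is_weak_partial ::
    "'a::euclidean_space set \<Rightarrow> 'a \<Rightarrow> ('a \<Rightarrow> real) \<Rightarrow> ('a \<Rightarrow> real) \<Rightarrow> bool" where
  "is_weak_partial U b f g \<longleftrightarrow>
     (\<forall>\<phi>\<in>test_functions U.
        (LINT x|lebesgue_on U. f x * frechet_derivative \<phi> (at x) b) =
        - (LINT x|lebesgue_on U. g x * \<phi> x))"

definition H1 :: "'a::euclidean_space set \<Rightarrow> ('a \<Rightarrow> real) set" where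
  "H1 U = {f \<in> L2 U. \<forall>b\<in>Basis. \<exists>g\<in>L2 U. is_weak_partial U b f g}"

text \<open>The weak partial derivative of an \<open>H\<^sup>1\<close> function is unique up to null sets; this is one
  representative of it.\<close>

definition weak_partial :: "'a::euclidean_space set \<Rightarrow> 'a \<Rightarrow> ('a \<Rightarrow> real) \<Rightarrow> 'a \<Rightarrow> real" where
  "weak_partial U b f = (SOME g. g \<in> L2 U \<and> is_weak_partial U b f g)"

definition H1_norm :: "'a::euclidean_space set \<Rightarrow> ('a \<Rightarrow> real) \<Rightarrow> real" where
  "H1_norm U f = sqrt ((Lp_norm (lebesgue_on U) 2 f)\<^sup>2 +
     (\<Sum>b\<in>Basis. (Lp_norm (lebesgue_on U) 2 (weak_partial U b f))\<^sup>2))"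

definition H10 :: "'a::euclidean_space set \<Rightarrow> ('a \<Rightarrow> real) set" where
  "H10 U = {f \<in> H1 U. \<exists>\<phi>. (\<forall>k::nat. \<phi> k \<in> test_functions U) \<and>
                          (\<lambda>k. H1_norm U (f - \<phi> k)) \<longlonglongrightarrow> 0}"

text \<open>\<open>H\<^sup>-\<^sup>1(U)\<close> is the space of bounded linear functionals on \<open>H\<^sub>0\<^sup>1(U)\<close>, with the dual norm.
  Boundedness forces such a functional to respect equality almost everywhere.\<close>

definition Hm1 :: "'a::euclidean_space set \<Rightarrow> (('a \<Rightarrow> real) \<Rightarrow> real) set" where
  "Hm1 U =
     {G. (\<forall>v\<in>H10 U. \<forall>w\<in>H10 U. G (\<lambda>x. v x + w x) = G v + G w) \<and>
         (\<forall>c. \<forall>v\<in>H10 U. G (\<lambda>x. c * v x) = c * G v) \<and>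
         (\<exists>C. \<forall>v\<in>H10 U. \<bar>G v\<bar> \<le> C * H1_norm U v)}"

definition Hm1_norm :: "'a::euclidean_space set \<Rightarrow> (('a \<Rightarrow> real) \<Rightarrow> real) \<Rightarrow> real" where
  "Hm1_norm U G = (SUP v\<in>{v \<in> H10 U. H1_norm U v \<le> 1}. \<bar>G v\<bar>)"

definition L2_H10 :: "'a::euclidean_space set \<Rightarrow> real \<Rightarrow> (real \<Rightarrow> 'a \<Rightarrow> real) set" where
  "L2_H10 \<Omega> T = bochner_space {0<..<T} 2 (H10 \<Omega>) (H1_norm \<Omega>)"

definition L2_Hm1 ::
    "'a::euclidean_space set \<Rightarrow> real \<Rightarrow> (real \<Rightarrow> ('a \<Rightarrow> real) \<Rightarrow> real) set" where
  "L2_Hm1 \<Omega> T = bochner_space {0<..<T} 2 (Hm1 \<Omega>) (Hm1_norm \<Omega>)"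

text \<open>\<open>w = \<partial>y/\<partial>t\<close> in the sense of \<open>H\<^sup>-\<^sup>1(\<Omega>)\<close>-valued distributions on \<open>(0,T)\<close>, where
  \<open>L\<^sup>2(\<Omega>)\<close> is embedded into \<open>H\<^sup>-\<^sup>1(\<Omega>)\<close> by means of the \<open>L\<^sup>2\<close> inner product.  The identity between
  \<open>H\<^sup>-\<^sup>1(\<Omega>)\<close>-valued integrals is evaluated at each \<open>v \<in> H\<^sub>0\<^sup>1(\<Omega>)\<close>.\<close>

definition is_time_derivative ::
    "'a::euclidean_space set \<Rightarrow> real \<Rightarrow> ('a \<times> real \<Rightarrow> real) \<Rightarrow>
      (real \<Rightarrow> ('a \<Rightarrow> real) \<Rightarrow> real) \<Rightarrow> bool" where
  "is_time_derivative \<Omega> T y w \<longleftrightarrow>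
     (\<forall>\<psi>\<in>test_functions {0<..<T}. \<forall>v\<in>H10 \<Omega>.
        (LINT t|lebesgue_on {0<..<T}. (LINT x|lebesgue_on \<Omega>. y (x, t) * v x) * deriv \<psi> t) =
        - (LINT t|lebesgue_on {0<..<T}. w t v * \<psi> t))"

definition W_space :: "'a::euclidean_space set \<Rightarrow> real \<Rightarrow> ('a \<times> real \<Rightarrow> real) set" where
  "W_space \<Omega> T =
     {y \<in> borel_measurable (lebesgue_on (cylinder \<Omega> T)).
        (\<lambda>t x. y (x, t)) \<in> L2_H10 \<Omega> T \<and> (\<exists>w\<in>L2_Hm1 \<Omega> T. is_time_derivative \<Omega> T y w)}"

text \<open>\<open>y(\<tau>) = z\<close> for \<open>\<tau> \<in> [0,T]\<close>, through the representative of \<open>y\<close> in \<open>C([0,T];L\<^sup>2(\<Omega>))\<close>.\<close>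

definition has_value_at_time ::
    "'a::euclidean_space set \<Rightarrow> real \<Rightarrow> ('a \<times> real \<Rightarrow> real) \<Rightarrow> real \<Rightarrow> ('a \<Rightarrow> real) \<Rightarrow> bool" where
  "has_value_at_time \<Omega> T y \<tau> z \<longleftrightarrow>
     (\<exists>Y. (\<forall>t\<in>{0..T}. Y t \<in> L2 \<Omega>) \<and>
          (\<forall>s\<in>{0..T}. ((\<lambda>t. Lp_norm (lebesgue_on \<Omega>) 2 (Y t - Y s)) \<longlongrightarrow> 0) (at s within {0..T})) \<and>
          (AE t in lebesgue_on {0<..<T}. AE x in lebesgue_on \<Omega>. Y t x = y (x, t)) \<and>
          (AE x in lebesgue_on \<Omega>. Y \<tau> x = z x))"


section \<open>Data of the control problem\<close>

definition elliptic_coefficients :: "(real^'n) set \<Rightarrow> (real^'n \<Rightarrow> real^'n^'n) \<Rightarrow> bool" where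
  "elliptic_coefficients \<Omega> A \<longleftrightarrow>
     (\<forall>i j. (\<lambda>x. A x $ i $ j) \<in> Lp_space (lebesgue_on \<Omega>) \<infinity>) \<and>
     (\<exists>\<Lambda>>0. AE x in lebesgue_on \<Omega>. \<forall>\<xi>.
        \<Lambda> * (norm \<xi>)\<^sup>2 \<le> (\<Sum>i\<in>UNIV. \<Sum>j\<in>UNIV. A x $ i $ j * \<xi> $ i * \<xi> $ j))"

definition caratheodory_C2 ::
    "(real^'n) set \<Rightarrow> real \<Rightarrow> ((real^'n) \<times> real \<Rightarrow> real \<Rightarrow> real) \<Rightarrow> bool" where
  "caratheodory_C2 \<Omega> T a \<longleftrightarrow>
     (\<forall>y. (\<lambda>q. a q y) \<in> borel_measurable (lebesgue_on (cylinder \<Omega> T))) \<and>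
     (AE q in lebesgue_on (cylinder \<Omega> T).
        continuous_on UNIV (a q) \<and>
        (\<forall>y. a q differentiable (at y) \<and> deriv (a q) differentiable (at y)) \<and>
        continuous_on UNIV (deriv (deriv (a q))))"

text \<open>The constants are uniform in \<open>(x,t)\<close>; \<open>(deriv ^^ j) (a q) y\<close> is the \<open>j\<close>-th derivative of \<open>a\<close> with
  respect to its last variable.\<close>

definition admissible_nonlinearity ::
    "(real^'n) set \<Rightarrow> real \<Rightarrow> ennreal \<Rightarrow> ennreal \<Rightarrow> ((real^'n) \<times> real \<Rightarrow> real \<Rightarrow> real) \<Rightarrow> bool" where
  "admissible_nonlinearity \<Omega> T r p a \<longleftrightarrow>
     caratheodory_C2 \<Omega> T a \<and>
     (\<exists>C. AE q in lebesgue_on (cylinder \<Omega> T). \<forall>y. C \<le> deriv (a q) y) \<and>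
     (\<lambda>q. a q 0) \<in> LrLp \<Omega> T r p \<and>
     (\<forall>M>0. \<exists>C>0. AE q in lebesgue_on (cylinder \<Omega> T).
        \<forall>y. \<bar>y\<bar> \<le> M \<longrightarrow> (\<forall>j\<in>{1,2}. \<bar>(deriv ^^ j) (a q) y\<bar> \<le> C)) \<and>
     (\<forall>\<rho>>0. \<forall>M>0. \<exists>\<epsilon>>0. AE q in lebesgue_on (cylinder \<Omega> T).
        \<forall>y1 y2. \<bar>y1\<bar> \<le> M \<and> \<bar>y2\<bar> \<le> M \<and> \<bar>y1 - y2\<bar> < \<epsilon> \<longrightarrow>
          \<bar>(deriv ^^ 2) (a q) y1 - (deriv ^^ 2) (a q) y2\<bar> < \<rho>)"

definition U_ad :: "'a::euclidean_space set \<Rightarrow> real \<Rightarrow> real \<Rightarrow> ('a \<times> real \<Rightarrow> real) set" where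
  "U_ad \<Omega> T \<gamma> =
     {u \<in> LrLp \<Omega> T \<infinity> 1.
        AE t in lebesgue_on {0<..<T}. Lp_norm (lebesgue_on \<Omega>) 1 (\<lambda>x. u (x, t)) \<le> \<gamma>}"


section \<open>State and adjoint equations\<close>

text \<open>The bilinear form of \<open>- \<Sum>\<^sub>i\<^sub>j \<partial>\<^sub>j (A\<^sub>i\<^sub>j \<partial>\<^sub>i y)\<close>; the adjoint operator has coefficients
  \<open>transpose (A x)\<close>.\<close>

definition elliptic_form ::
    "(real^'n) set \<Rightarrow> (real^'n \<Rightarrow> real^'n^'n) \<Rightarrow> (real^'n \<Rightarrow> real) \<Rightarrow> (real^'n \<Rightarrow> real) \<Rightarrow> real" where
  "elliptic_form \<Omega> A y v =
     (LINT x|lebesgue_on \<Omega>. (\<Sum>i\<in>UNIV. \<Sum>j\<in>UNIV.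
        A x $ i $ j * weak_partial \<Omega> (axis i 1) y x * weak_partial \<Omega> (axis j 1) v x))"

definition is_state ::
    "(real^'n) set \<Rightarrow> real \<Rightarrow> (real^'n \<Rightarrow> real^'n^'n) \<Rightarrow> ((real^'n) \<times> real \<Rightarrow> real \<Rightarrow> real) \<Rightarrow>
      (real^'n \<Rightarrow> real) \<Rightarrow> ((real^'n) \<times> real \<Rightarrow> real) \<Rightarrow> ((real^'n) \<times> real \<Rightarrow> real) \<Rightarrow> bool" where
  "is_state \<Omega> T A a y0 u y \<longleftrightarrow>
     y \<in> Linf_Q \<Omega> T \<inter> W_space \<Omega> T \<and>
     (\<exists>w\<in>L2_Hm1 \<Omega> T. is_time_derivative \<Omega> T y w \<and>
        (AE t in lebesgue_on {0<..<T}. \<forall>v\<in>H10 \<Omega>.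
           w t v + elliptic_form \<Omega> A (\<lambda>x. y (x, t)) v
             + (LINT x|lebesgue_on \<Omega>. a (x, t) (y (x, t)) * v x)
           = (LINT x|lebesgue_on \<Omega>. u (x, t) * v x))) \<and>
     has_value_at_time \<Omega> T y 0 y0"

definition is_adjoint_state ::
    "(real^'n) set \<Rightarrow> real \<Rightarrow> (real^'n \<Rightarrow> real^'n^'n) \<Rightarrow> ((real^'n) \<times> real \<Rightarrow> real \<Rightarrow> real) \<Rightarrow>
      ((real^'n) \<times> real \<Rightarrow> real) \<Rightarrow> ((real^'n) \<times> real \<Rightarrow> real) \<Rightarrow> ((real^'n) \<times> real \<Rightarrow> real) \<Rightarrow> bool" where
  "is_adjoint_state \<Omega> T A a yd y \<phi> \<longleftrightarrow>
     \<phi> \<in> W_space \<Omega> T \<and>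
     (\<exists>w\<in>L2_Hm1 \<Omega> T. is_time_derivative \<Omega> T \<phi> w \<and>
        (AE t in lebesgue_on {0<..<T}. \<forall>v\<in>H10 \<Omega>.
           - w t v + elliptic_form \<Omega> (\<lambda>x. transpose (A x)) (\<lambda>x. \<phi> (x, t)) v
             + (LINT x|lebesgue_on \<Omega>. deriv (a (x, t)) (y (x, t)) * \<phi> (x, t) * v x)
           = (LINT x|lebesgue_on \<Omega>. (y (x, t) - yd (x, t)) * v x))) \<and>
     has_value_at_time \<Omega> T \<phi> T (\<lambda>x. 0)"

end

theory Submission
  imports Defs
begin

text \<open>
  At almost every point \<open>(x,t)\<close> the sign condition \<open>u \<mu> = \<bar>u\<bar> \<bar>\<mu>\<bar>\<close> turns \<open>\<phi> = - \<kappa> u - \<mu>\<close> into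
  \<open>\<bar>\<phi>\<bar> = \<kappa> \<bar>u\<bar> + \<bar>\<mu>\<bar>\<close>.  Write \<open>N(t)\<close> for the norm of \<open>\<mu>(t)\<close> in \<open>L\<^sup>\<infinity>(\<Omega>)\<close>.  If \<open>u(x,t) = 0\<close>, then
  \<open>\<bar>\<phi>(x,t)\<bar> = \<bar>\<mu>(x,t)\<bar> \<le> N(t)\<close>.  If \<open>u(x,t) \<noteq> 0\<close>, then \<open>\<bar>\<mu>(x,t)\<bar> = N(t)\<close>: either \<open>\<mu>(t)\<close> vanishes and
  both sides are 0, or the constraint on \<open>u(t)\<close> is active and \<open>\<bar>\<mu>(t)\<bar>\<close> attains its norm on the
  support of \<open>u(t)\<close>; hence \<open>\<bar>\<phi>(x,t)\<bar> = \<kappa> \<bar>u(x,t)\<bar> + N(t) > N(t)\<close>.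

  The argument takes place on the time slices, whereas hypotheses and conclusion concern
  almost every point of the cylinder.  Going from the cylinder to the slices is Fubini's theorem
  (\<open>AE_cylinder_imp_AE_slices\<close>).  The way back (\<open>AE_slices_imp_AE_cylinder\<close>) is valid for Lebesgue
  measurable sets only, so \<open>N\<close> has to be measurable: up to a null set of times it is a Borel
  function, because the essential supremum of a slice is at most \<open>c\<close> iff the
  superlevel set \<open>{\<bar>\<mu>(t)\<bar> > c}\<close> has measure 0, and that measure depends measurably on \<open>t\<close>
  (\<open>Linf_norm_of_slices_AE_eq_borel\<close>).
\<close>

section \<open>Null sets of the cylinder and of its time slices\<close>

lemma AE_lebesgue_on_iff_lborel:
  assumes "S \<in> sets lebesgue"
  shows "(AE x in lebesgue_on S. P x) \<longleftrightarrow> (AE x in lborel. x \<in> S \<longrightarrow> P x)"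
  using assms by (simp add: AE_restrict_space_iff AE_completion_iff)

lemma open_cylinder:
  fixes \<Omega> :: "'a::euclidean_space set"
  assumes "open \<Omega>"
  shows "open (cylinder \<Omega> T)"
  unfolding cylinder_def using assms by (intro open_Times) auto

lemma snd_borel_measurable:
  "(snd :: 'a::topological_space \<times> 'b::topological_space \<Rightarrow> 'b) \<in> borel \<rightarrow>\<^sub>M borel"
  by (intro borel_measurable_continuous_onI continuous_intros)

lemma AE_lborel_prod_commute:
  fixes P :: "'a::euclidean_space \<Rightarrow> 'b::euclidean_space \<Rightarrow> bool"
  assumes "{q. P (fst q) (snd q)} \<in> sets (borel :: ('a \<times> 'b) measure)"
  shows "(AE x in lborel. AE t in lborel. P x t) \<longleftrightarrow> (AE t in lborel. AE x in lborel. P x t)"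
proof (rule lborel_pair.AE_commute)
  have *: "sets (lborel \<Otimes>\<^sub>M lborel :: ('a \<times> 'b) measure) = sets borel"
    unfolding lborel_prod by simp
  show "{x \<in> space (lborel \<Otimes>\<^sub>M lborel). P (fst x) (snd x)} \<in> sets (lborel \<Otimes>\<^sub>M lborel :: ('a \<times> 'b) measure)"
    unfolding * using assms by (simp add: space_pair_measure)
qed

lemma AE_lborel_imp_AE_slices:
  fixes P :: "'a::euclidean_space \<times> 'b::euclidean_space \<Rightarrow> bool"
  assumes "AE q in lborel. P q"
  shows "AE t in lborel. AE x in lborel. P (x, t)"
proof -
  obtain N where N: "{q. \<not> P q} \<subseteq> N" "emeasure lborel N = 0" "N \<in> sets borel"
    using assms by (auto elim!: AE_E)
  have "AE q in lborel. q \<notin> N"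
    using N by (intro AE_not_in) (auto simp: null_sets_def)
  then have "AE x in lborel. AE t in lborel. (x, t) \<notin> N"
    unfolding lborel_prod[symmetric] by (rule lborel_pair.AE_pair)
  moreover have "{q. (fst q, snd q) \<notin> N} \<in> sets borel"
    using N(3) by (simp add: borel_comp Compl_eq[symmetric])
  ultimately have "AE t in lborel. AE x in lborel. (x, t) \<notin> N"
    by (subst (asm) AE_lborel_prod_commute) auto
  then show ?thesis
    using N(1) by (auto elim!: eventually_mono)
qed

text \<open>A Lebesgue measurable set is a Borel set up to a null set, and that null set has null slices
  by the previous lemma; this reduces the statement to Tonelli's theorem for Borel sets.\<close>

lemma AE_slices_imp_AE_lborel:
  fixes G :: "('a::euclidean_space \<times> 'b::euclidean_space) set"
  assumes G: "G \<in> sets lebesgue"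
    and slices: "AE t in lborel. AE x in lborel. (x, t) \<in> G"
  shows "AE q in lborel. q \<in> G"
proof -
  define B where "B = main_part lborel G"
  have B: "B \<in> sets borel"
    unfolding B_def using main_part_sets[OF G] by simp
  have eq: "AE q in lborel. q \<in> B \<longleftrightarrow> q \<in> G"
    unfolding B_def by (rule AE_in_main_part[OF G])
  have "AE t in lborel. AE x in lborel. (x, t) \<in> B"
    using AE_lborel_imp_AE_slices[OF eq] slices
  proof eventually_elim
    case (elim t)
    then show ?case by eventually_elim simp
  qed
  then have "AE x in lborel. AE t in lborel. (x, t) \<in> B"
    using B by (subst AE_lborel_prod_commute) auto
  moreover have "{q \<in> space (lborel \<Otimes>\<^sub>M lborel). q \<in> B} \<in> sets (lborel \<Otimes>\<^sub>M lborel)"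
    unfolding lborel_prod using B by simp
  ultimately have "AE q in lborel. q \<in> B"
    unfolding lborel_prod[symmetric] by (intro lborel_pair.AE_pair_measure)
  with eq show ?thesis by eventually_elim simp
qed

lemma AE_cylinder_imp_AE_slices:
  fixes \<Omega> :: "'a::euclidean_space set"
  assumes \<Omega>: "open \<Omega>" and P: "AE q in lebesgue_on (cylinder \<Omega> T). P q"
  shows "AE t in lebesgue_on {0<..<T}. AE x in lebesgue_on \<Omega>. P (x, t)"
proof -
  have "AE q in lborel. q \<in> cylinder \<Omega> T \<longrightarrow> P q"
    using P open_cylinder[OF \<Omega>, of T] by (simp add: AE_lebesgue_on_iff_lborel)
  from AE_lborel_imp_AE_slices[OF this] show ?thesis
    using \<Omega> by (auto simp: AE_lebesgue_on_iff_lborel cylinder_def elim!: eventually_mono)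
qed

lemma AE_slices_imp_AE_cylinder:
  fixes \<Omega> :: "'a::euclidean_space set"
  assumes \<Omega>: "open \<Omega>"
    and meas: "{q \<in> cylinder \<Omega> T. P q} \<in> sets lebesgue"
    and slices: "AE t in lebesgue_on {0<..<T}. AE x in lebesgue_on \<Omega>. P (x, t)"
  shows "AE q in lebesgue_on (cylinder \<Omega> T). P q"
proof -
  define G where "G = {q \<in> cylinder \<Omega> T. P q} \<union> - cylinder \<Omega> T"
  have cyl: "cylinder \<Omega> T \<in> sets lebesgue"
    using open_cylinder[OF \<Omega>, of T] by simp
  then have G: "G \<in> sets lebesgue"
    unfolding G_def using meas
    by (intro sets.Un) (auto simp: sets.compl_sets Compl_in_sets_lebesgue)
  have "AE t in lborel. t \<in> {0<..<T} \<longrightarrow> (AE x in lborel. x \<in> \<Omega> \<longrightarrow> P (x, t))"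
    using slices \<Omega> by (simp add: AE_lebesgue_on_iff_lborel)
  then have "AE t in lborel. AE x in lborel. (x, t) \<in> G"
    by eventually_elim (auto simp: G_def cylinder_def)
  from AE_slices_imp_AE_lborel[OF G this] show ?thesis
    by (subst AE_lebesgue_on_iff_lborel[OF cyl]) (auto simp: G_def elim!: eventually_mono)
qed

lemma AE_time_imp_AE_cylinder:
  fixes \<Omega> :: "'a::euclidean_space set"
  assumes \<Omega>: "open \<Omega>" and P: "AE t in lebesgue_on {0<..<T}. P t"
  shows "AE q in lebesgue_on (cylinder \<Omega> T). P (snd q)"
proof -
  have "AE t in lborel. t \<in> {0<..<T} \<longrightarrow> P t"
    using P by (simp add: AE_lebesgue_on_iff_lborel)
  then obtain N where N: "{t. \<not> (t \<in> {0<..<T} \<longrightarrow> P t)} \<subseteq> N" "emeasure lborel N = 0" "N \<in> sets borel"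
    by (auto elim!: AE_E)
  have "AE t in lborel. t \<notin> N"
    using N by (intro AE_not_in) (auto simp: null_sets_def)
  then have "AE t in lborel. AE x in (lborel :: 'a measure). (x, t) \<in> snd -` (- N)"
    by (auto elim!: eventually_mono)
  moreover have "snd -` (- N) \<in> sets (borel :: ('a \<times> real) measure)"
    using measurable_sets[OF snd_borel_measurable borel_comp[OF N(3)]] by simp
  then have "snd -` (- N) \<in> sets (lebesgue :: ('a \<times> real) measure)" by simp
  ultimately have "AE q in (lborel :: ('a \<times> real) measure). q \<in> snd -` (- N)"
    by (rule AE_slices_imp_AE_lborel[rotated])
  then show ?thesis
    using N(1) open_cylinder[OF \<Omega>, of T]
    by (auto simp: AE_lebesgue_on_iff_lborel cylinder_def elim!: eventually_mono)
qed

section \<open>The supremum norm of the time slices\<close>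

lemma esssup_le_iff:
  "f \<in> borel_measurable M \<Longrightarrow> esssup M f \<le> c \<longleftrightarrow> (AE x in M. f x \<le> c)"
  using esssup_AE[of f M] by (auto intro: esssup_I elim!: eventually_mono)

text \<open>The hypothesis excludes an infinite essential supremum, which \<open>Lp_norm\<close> would turn into 0.\<close>

lemma AE_le_Linf_norm:
  assumes "f \<in> Lp_space M \<infinity>"
  shows "AE x in M. \<bar>f x\<bar> \<le> Lp_norm M \<infinity> f"
proof -
  have fin: "esssup M (\<lambda>x. ereal \<bar>f x\<bar>) < \<infinity>"
    using assms by (simp add: Lp_space_def)
  have "\<bar>f x\<bar> \<le> Lp_norm M \<infinity> f" if "ereal \<bar>f x\<bar> \<le> esssup M (\<lambda>x. ereal \<bar>f x\<bar>)" for x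
    using that fin by (cases "esssup M (\<lambda>x. ereal \<bar>f x\<bar>)") (auto simp: Lp_norm_def)
  then show ?thesis
    using esssup_AE[of "\<lambda>x. ereal \<bar>f x\<bar>" M] by (auto elim!: eventually_mono)
qed

lemma Linf_norm_cong_AE:
  assumes "f \<in> borel_measurable M" "g \<in> borel_measurable M" "AE x in M. f x = g x"
  shows "Lp_norm M \<infinity> f = Lp_norm M \<infinity> g"
proof -
  have "esssup M (\<lambda>x. ereal \<bar>f x\<bar>) = esssup M (\<lambda>x. ereal \<bar>g x\<bar>)"
    using assms by (intro esssup_AE_cong) auto
  then show ?thesis by (simp add: Lp_norm_def)
qed

text \<open>The essential supremum over a null space is \<open>-\<infinity>\<close>, which \<open>Lp_norm\<close> also turns into 0.\<close>

lemma Linf_norm_eq_0: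
  assumes "f \<in> borel_measurable M" "AE x in M. f x = 0"
  shows "Lp_norm M \<infinity> f = 0"
proof -
  have eq: "esssup M (\<lambda>x. ereal \<bar>f x\<bar>) = esssup M (\<lambda>x. 0)"
    using assms by (intro esssup_AE_cong) (auto elim!: eventually_mono)
  show ?thesis
  proof (cases "emeasure M (space M) = 0")
    case True
    then have "esssup M (\<lambda>x. 0 :: ereal) = -\<infinity>"
      by (simp add: esssup_def bot_ereal_def ae_filter_eq_bot_iff[THEN iffD2])
    with eq show ?thesis by (simp add: Lp_norm_def)
  next
    case False
    with eq show ?thesis by (simp add: Lp_norm_def esssup_const)
  qed
qed

lemma borel_slice_measurable:
  fixes h :: "'a::euclidean_space \<times> real \<Rightarrow> real"
  assumes [measurable]: "h \<in> borel_measurable borel"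
  shows "(\<lambda>x. h (x, t)) \<in> borel_measurable (lebesgue_on \<Omega>)"
proof -
  have "(\<lambda>x. (x, t)) \<in> borel \<rightarrow>\<^sub>M borel"
    by (intro borel_measurable_continuous_onI continuous_intros)
  from measurable_comp[OF this assms] have "(\<lambda>x. h (x, t)) \<in> borel_measurable borel"
    by (simp add: comp_def)
  then show ?thesis
    by (intro measurable_restrict_space1 measurable_completion) simp
qed

text \<open>By Fubini's theorem almost every slice of \<open>f\<close> agrees almost everywhere with the slice of
  a Borel version of \<open>f\<close>, and completeness of the Lebesgue measure makes it measurable.\<close>

lemma borel_version_of_slices:
  fixes f :: "'a::euclidean_space \<times> real \<Rightarrow> real"
  assumes \<Omega>: "open \<Omega>" and f: "f \<in> borel_measurable (lebesgue_on (cylinder \<Omega> T))"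
  obtains h where "h \<in> borel_measurable borel"
    and "AE t in lebesgue_on {0<..<T}. (\<lambda>x. f (x, t)) \<in> borel_measurable (lebesgue_on \<Omega>) \<and>
           (AE x in lebesgue_on \<Omega>. f (x, t) = h (x, t))"
proof -
  have cyl: "cylinder \<Omega> T \<in> sets lebesgue"
    using open_cylinder[OF \<Omega>, of T] by simp
  have "(\<lambda>q. if q \<in> cylinder \<Omega> T then f q else 0) \<in> borel_measurable lebesgue"
    using f cyl by (simp add: borel_measurable_if)
  then obtain h where h: "h \<in> borel_measurable borel"
    and eq: "AE q in lborel. (if q \<in> cylinder \<Omega> T then f q else 0) = h q"
    by (auto dest!: completion_ex_borel_measurable_real)
  have "AE q in lebesgue_on (cylinder \<Omega> T). f q = h q"
    using eq cyl by (auto simp: AE_lebesgue_on_iff_lborel elim!: eventually_mono)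
  then have slices: "AE t in lebesgue_on {0<..<T}. AE x in lebesgue_on \<Omega>. f (x, t) = h (x, t)"
    by (rule AE_cylinder_imp_AE_slices[OF \<Omega>])
  have "(\<lambda>x. f (x, t)) \<in> borel_measurable (lebesgue_on \<Omega>)"
    if "AE x in lebesgue_on \<Omega>. f (x, t) = h (x, t)" for t
  proof -
    have "(\<lambda>x. if x \<in> \<Omega> then h (x, t) else 0) \<in> borel_measurable lebesgue"
      using borel_slice_measurable[OF h, of t \<Omega>] \<Omega> by (simp add: borel_measurable_if)
    moreover have "AE x in lebesgue. (if x \<in> \<Omega> then h (x, t) else 0) = (if x \<in> \<Omega> then f (x, t) else 0)"
      using that \<Omega> by (auto simp: AE_restrict_space_iff elim!: eventually_mono)
    ultimately have "(\<lambda>x. if x \<in> \<Omega> then f (x, t) else 0) \<in> borel_measurable lebesgue"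
      by (rule borel_measurable_AE)
    then show ?thesis by (rule borel_measurable_if_D)
  qed
  with slices have "AE t in lebesgue_on {0<..<T}. (\<lambda>x. f (x, t)) \<in> borel_measurable (lebesgue_on \<Omega>) \<and>
           (AE x in lebesgue_on \<Omega>. f (x, t) = h (x, t))"
    by (auto elim!: eventually_mono)
  with h show thesis by (rule that)
qed

text \<open>The essential supremum of the slice at time \<open>t\<close> is at most \<open>c\<close> iff the slice at \<open>t\<close> of the
  superlevel set \<open>{\<bar>h\<bar> > c}\<close> is a null set.  The measure of the slices of a Borel set is a
  measurable function of \<open>t\<close> by Tonelli's theorem.\<close>

lemma Linf_norm_of_borel_slices_measurable:
  fixes h :: "'a::euclidean_space \<times> real \<Rightarrow> real"
  assumes \<Omega>: "open \<Omega>" and h: "h \<in> borel_measurable borel"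
  shows "(\<lambda>t. Lp_norm (lebesgue_on \<Omega>) \<infinity> (\<lambda>x. h (x, t))) \<in> borel_measurable borel"
proof -
  define E where "E = (\<lambda>t. esssup (lebesgue_on \<Omega>) (\<lambda>x. ereal \<bar>h (x, t)\<bar>))"
  have "{t. E t \<le> c} \<in> sets borel" for c
  proof -
    define S where "S = {q \<in> \<Omega> \<times> UNIV. c < ereal \<bar>h q\<bar>}"
    have S: "S \<in> sets (lborel \<Otimes>\<^sub>M lborel)"
    proof -
      have "\<Omega> \<times> (UNIV :: real set) \<in> sets borel"
        using \<Omega> by (intro borel_open open_Times) auto
      moreover have "{q. c < ereal \<bar>h q\<bar>} \<in> sets borel"
        using h by measurable
      ultimately have "(\<Omega> \<times> UNIV) \<inter> {q. c < ereal \<bar>h q\<bar>} \<in> sets borel" by (rule sets.Int)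
      then show ?thesis
        unfolding lborel_prod by (simp add: S_def Int_def)
    qed
    have "E t \<le> c \<longleftrightarrow> emeasure lborel ((\<lambda>x. (x, t)) -` S) = 0" for t
    proof -
      have slice: "(\<lambda>x. (x, t)) -` S \<in> sets lborel"
        using S by (rule sets_Pair2)
      have "E t \<le> c \<longleftrightarrow> (AE x in lebesgue_on \<Omega>. ereal \<bar>h (x, t)\<bar> \<le> c)"
        unfolding E_def using borel_slice_measurable[OF h, of t \<Omega>] by (intro esssup_le_iff) simp
      also have "\<dots> \<longleftrightarrow> (AE x in lborel. x \<notin> (\<lambda>x. (x, t)) -` S)"
        using \<Omega> by (subst AE_lebesgue_on_iff_lborel) (auto simp: S_def not_less)
      also have "\<dots> \<longleftrightarrow> emeasure lborel ((\<lambda>x. (x, t)) -` S) = 0"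
        using slice by (subst AE_iff_measurable[OF _ refl]) (simp_all add: vimage_def)
      finally show ?thesis .
    qed
    then have "{t. E t \<le> c} = (\<lambda>t. emeasure lborel ((\<lambda>x. (x, t)) -` S)) -` {0}"
      by auto
    also have "\<dots> \<in> sets borel"
      using measurable_sets[OF lborel_pair.measurable_emeasure_Pair2[OF S], of "{0}"] by simp
    finally show ?thesis .
  qed
  then have "E \<in> borel_measurable borel"
    by (simp add: borel_measurable_iff_Iic_ereal vimage_def)
  then show ?thesis by (simp add: Lp_norm_def E_def)
qed

lemma Linf_norm_of_slices_AE_eq_borel:
  fixes f :: "'a::euclidean_space \<times> real \<Rightarrow> real"
  assumes \<Omega>: "open \<Omega>" and f: "f \<in> borel_measurable (lebesgue_on (cylinder \<Omega> T))"
  obtains g where "g \<in> borel_measurable borel"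
    and "AE t in lebesgue_on {0<..<T}. Lp_norm (lebesgue_on \<Omega>) \<infinity> (\<lambda>x. f (x, t)) = g t"
proof -
  obtain h where h: "h \<in> borel_measurable borel"
    and eq: "AE t in lebesgue_on {0<..<T}. (\<lambda>x. f (x, t)) \<in> borel_measurable (lebesgue_on \<Omega>) \<and>
           (AE x in lebesgue_on \<Omega>. f (x, t) = h (x, t))"
    using borel_version_of_slices[OF \<Omega> f] by blast
  show thesis
  proof (rule that)
    show "(\<lambda>t. Lp_norm (lebesgue_on \<Omega>) \<infinity> (\<lambda>x. h (x, t))) \<in> borel_measurable borel"
      using \<Omega> h by (rule Linf_norm_of_borel_slices_measurable)
    show "AE t in lebesgue_on {0<..<T}. Lp_norm (lebesgue_on \<Omega>) \<infinity> (\<lambda>x. f (x, t)) =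
        Lp_norm (lebesgue_on \<Omega>) \<infinity> (\<lambda>x. h (x, t))"
      using eq
      by eventually_elim (intro Linf_norm_cong_AE borel_slice_measurable[OF h], auto)
  qed
qed

lemma slices_of_Linf_Q:
  assumes \<Omega>: "open \<Omega>" and f: "f \<in> Linf_Q \<Omega> T"
  shows "AE t in lebesgue_on {0<..<T}. (\<lambda>x. f (x, t)) \<in> Lp_space (lebesgue_on \<Omega>) \<infinity>"
proof -
  have fm: "f \<in> borel_measurable (lebesgue_on (cylinder \<Omega> T))"
    using f by (simp add: Linf_Q_def Lp_space_def)
  obtain h where meas: "AE t in lebesgue_on {0<..<T}. (\<lambda>x. f (x, t)) \<in> borel_measurable (lebesgue_on \<Omega>) \<and>
           (AE x in lebesgue_on \<Omega>. f (x, t) = h (x, t))"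
    using borel_version_of_slices[OF \<Omega> fm] by blast
  define K where "K = Lp_norm (lebesgue_on (cylinder \<Omega> T)) \<infinity> f"
  have "AE q in lebesgue_on (cylinder \<Omega> T). \<bar>f q\<bar> \<le> K"
    unfolding K_def using f by (intro AE_le_Linf_norm) (simp add: Linf_Q_def)
  from AE_cylinder_imp_AE_slices[OF \<Omega> this] meas show ?thesis
  proof eventually_elim
    case (elim t)
    then have "esssup (lebesgue_on \<Omega>) (\<lambda>x. ereal \<bar>f (x, t)\<bar>) \<le> ereal K"
      by (intro esssup_I) auto
    with elim show ?case
      by (auto simp: Lp_space_def intro: le_less_trans)
  qed
qed

section \<open>Sparsity of the control\<close>

text \<open>The sign condition says that \<open>\<kappa> u\<close> and \<open>\<mu>\<close> do not have opposite signs, so that their absolute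
  values add up to \<open>\<bar>\<phi>\<bar>\<close>, without cancellation.\<close>

lemma zero_iff_of_aligned:
  fixes \<phi> \<kappa> u \<mu> N :: real
  assumes "0 < \<kappa>" "\<phi> + \<kappa> * u + \<mu> = 0" "u * \<mu> = \<bar>u\<bar> * \<bar>\<mu>\<bar>"
    and "\<bar>\<mu>\<bar> \<le> N" "u \<noteq> 0 \<Longrightarrow> \<bar>\<mu>\<bar> = N"
  shows "u = 0 \<longleftrightarrow> \<bar>\<phi>\<bar> \<le> N"
proof (cases "u = 0")
  case True
  with assms show ?thesis by auto
next
  case False
  have "(\<kappa> * u) * \<mu> = \<bar>\<kappa> * u\<bar> * \<bar>\<mu>\<bar>"
    using assms(1,3) by (simp add: abs_mult mult.assoc)
  then have "0 \<le> (\<kappa> * u) * \<mu>" by simp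
  then have "\<bar>\<kappa> * u + \<mu>\<bar> = \<bar>\<kappa> * u\<bar> + \<bar>\<mu>\<bar>"
    by (auto simp: zero_le_mult_iff)
  moreover have "\<bar>\<phi>\<bar> = \<bar>\<kappa> * u + \<mu>\<bar>"
    using assms(2) by linarith
  moreover have "0 < \<bar>\<kappa> * u\<bar>"
    using False assms(1) by simp
  ultimately show ?thesis
    using False assms(5) by linarith
qed

theorem corollary3p6:
  fixes \<Omega> :: "(real^'n) set"
    and T \<kappa> \<gamma> :: real
    and rhat phat :: ennreal
    and A :: "real^'n \<Rightarrow> real^'n^'n"
    and a :: "(real^'n) \<times> real \<Rightarrow> real \<Rightarrow> real"
    and y0 :: "real^'n \<Rightarrow> real"
    and yd u y \<phi> \<mu> :: "(real^'n) \<times> real \<Rightarrow> real"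
  assumes dim: "CARD('n) \<in> {2, 3}"
    and domain: "bounded \<Omega>" "connected \<Omega>" "open \<Omega>" "lipschitz_boundary \<Omega>"
    and T: "0 < T"
    and A: "elliptic_coefficients \<Omega> A"
    and y0: "y0 \<in> Lp_space (lebesgue_on \<Omega>) \<infinity>"
    and exponents: "2 \<le> rhat" "2 \<le> phat" "1 / rhat + of_nat CARD('n) / (2 * phat) < 1"
    and a: "admissible_nonlinearity \<Omega> T rhat phat a"
    and yd: "yd \<in> LrLp \<Omega> T rhat phat"
    and \<kappa>: "0 < \<kappa>"
    and \<gamma>: "0 < \<gamma>"
    and u: "u \<in> U_ad \<Omega> T \<gamma> \<inter> Linf_Q \<Omega> T"
    and y: "is_state \<Omega> T A a y0 u y"
    and \<phi>: "is_adjoint_state \<Omega> T A a yd y \<phi>"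
      "continuous_on (closure (cylinder \<Omega> T)) \<phi>" "\<phi> \<in> H1 (cylinder \<Omega> T)"
    and \<mu>: "\<mu> \<in> Linf_Q \<Omega> T"
    and optimality: "AE q in lebesgue_on (cylinder \<Omega> T). \<phi> q + \<kappa> * u q + \<mu> q = 0"
    and cond_a: "AE q in lebesgue_on (cylinder \<Omega> T). u q * \<mu> q = \<bar>u q\<bar> * \<bar>\<mu> q\<bar>"
    and cond_b: "AE t in lebesgue_on {0<..<T}.
      Lp_norm (lebesgue_on \<Omega>) 1 (\<lambda>x. u (x, t)) < \<gamma> \<longrightarrow>
      (AE x in lebesgue_on \<Omega>. \<mu> (x, t) = 0)"
    and cond_c: "AE t in lebesgue_on {0<..<T}.
      Lp_norm (lebesgue_on \<Omega>) 1 (\<lambda>x. u (x, t)) = \<gamma> \<and>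
      \<not> (AE x in lebesgue_on \<Omega>. \<mu> (x, t) = 0) \<longrightarrow>
      (AE x in lebesgue_on \<Omega>. x \<in> {x \<in> \<Omega>. u (x, t) \<noteq> 0} \<longrightarrow>
         x \<in> {x \<in> \<Omega>. \<bar>\<mu> (x, t)\<bar> = Lp_norm (lebesgue_on \<Omega>) \<infinity> (\<lambda>x. \<mu> (x, t))})"
  shows "AE (x, t) in lebesgue_on (cylinder \<Omega> T).
    u (x, t) = 0 \<longleftrightarrow> \<bar>\<phi> (x, t)\<bar> \<le> Lp_norm (lebesgue_on \<Omega>) \<infinity> (\<lambda>x. \<mu> (x, t))"
proof -
  define N where "N t = Lp_norm (lebesgue_on \<Omega>) \<infinity> (\<lambda>x. \<mu> (x, t))" for t
  have \<Omega>: "open \<Omega>" by fact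
  have um: "u \<in> borel_measurable (lebesgue_on (cylinder \<Omega> T))"
    using u by (simp add: Linf_Q_def Lp_space_def)
  have \<mu>m: "\<mu> \<in> borel_measurable (lebesgue_on (cylinder \<Omega> T))"
    using \<mu> by (simp add: Linf_Q_def Lp_space_def)
  have \<phi>m: "\<phi> \<in> borel_measurable (lebesgue_on (cylinder \<Omega> T))"
    using \<phi>(1) by (simp add: is_adjoint_state_def W_space_def)

  have budget: "AE t in lebesgue_on {0<..<T}. Lp_norm (lebesgue_on \<Omega>) 1 (\<lambda>x. u (x, t)) \<le> \<gamma>"
    using u by (simp add: U_ad_def)
  have slices: "AE t in lebesgue_on {0<..<T}. AE x in lebesgue_on \<Omega>.
      u (x, t) = 0 \<longleftrightarrow> \<bar>\<phi> (x, t)\<bar> \<le> N t"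
    using AE_cylinder_imp_AE_slices[OF \<Omega> optimality] AE_cylinder_imp_AE_slices[OF \<Omega> cond_a]
      budget cond_b cond_c slices_of_Linf_Q[OF \<Omega> \<mu>]
  proof eventually_elim
    case (elim t)
    have bound: "AE x in lebesgue_on \<Omega>. \<bar>\<mu> (x, t)\<bar> \<le> N t"
      unfolding N_def using elim(6) by (rule AE_le_Linf_norm)
    have attained: "AE x in lebesgue_on \<Omega>. u (x, t) \<noteq> 0 \<longrightarrow> \<bar>\<mu> (x, t)\<bar> = N t"
    proof (cases "AE x in lebesgue_on \<Omega>. \<mu> (x, t) = 0")
      case True
      moreover from this have "N t = 0"
        unfolding N_def using elim(6) by (intro Linf_norm_eq_0) (simp_all add: Lp_space_def)
      ultimately show ?thesis by (auto elim!: eventually_mono)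
    next
      case False
      \<comment> \<open>Below the budget \<open>\<gamma>\<close> the multiplier would vanish, so the constraint is active here.\<close>
      with elim have "AE x in lebesgue_on \<Omega>. x \<in> {x \<in> \<Omega>. u (x, t) \<noteq> 0} \<longrightarrow>
         x \<in> {x \<in> \<Omega>. \<bar>\<mu> (x, t)\<bar> = N t}"
        unfolding N_def by linarith
      then show ?thesis
        using AE_space[of "lebesgue_on \<Omega>"] by eventually_elim auto
    qed
    from elim(1,2) bound attained show ?case
      by eventually_elim (rule zero_iff_of_aligned[OF \<kappa>], auto)
  qed

  \<comment> \<open>Measurability of the set of good points, which the return to the cylinder requires, is clear
    once \<open>N\<close> is replaced by a Borel function.\<close>
  obtain g where g: "g \<in> borel_measurable borel" and Ng: "AE t in lebesgue_on {0<..<T}. N t = g t"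
    unfolding N_def using Linf_norm_of_slices_AE_eq_borel[OF \<Omega> \<mu>m] by blast
  have cyl: "cylinder \<Omega> T \<in> sets lebesgue"
    using open_cylinder[OF \<Omega>, of T] by simp
  have "AE q in lebesgue_on (cylinder \<Omega> T). u q = 0 \<longleftrightarrow> \<bar>\<phi> q\<bar> \<le> g (snd q)"
  proof (rule AE_slices_imp_AE_cylinder[OF \<Omega>])
    have "(\<lambda>q. g (snd q)) \<in> borel_measurable borel"
      using measurable_comp[OF snd_borel_measurable g] by (simp add: comp_def)
    then have "(\<lambda>q. g (snd q)) \<in> borel_measurable (lebesgue_on (cylinder \<Omega> T))"
      by (intro measurable_restrict_space1 measurable_completion) simp
    note [measurable] = this um \<phi>m
    have "{q \<in> space (lebesgue_on (cylinder \<Omega> T)). u q = 0 \<longleftrightarrow> \<bar>\<phi> q\<bar> \<le> g (snd q)}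
        \<in> sets (lebesgue_on (cylinder \<Omega> T))"
      by measurable
    then show "{q \<in> cylinder \<Omega> T. u q = 0 \<longleftrightarrow> \<bar>\<phi> q\<bar> \<le> g (snd q)} \<in> sets lebesgue"
      using cyl by (simp add: sets_restrict_space_iff)
    show "AE t in lebesgue_on {0<..<T}. AE x in lebesgue_on \<Omega>.
        u (x, t) = 0 \<longleftrightarrow> \<bar>\<phi> (x, t)\<bar> \<le> g (snd (x, t))"
      using slices Ng by eventually_elim simp
  qed
  with AE_time_imp_AE_cylinder[OF \<Omega> Ng]
  have "AE q in lebesgue_on (cylinder \<Omega> T). u q = 0 \<longleftrightarrow> \<bar>\<phi> q\<bar> \<le> N (snd q)"
    by eventually_elim simp
  then show ?thesis
    by (simp add: N_def case_prod_beta)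
qed

end
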